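(* For every $t\in \mathbb{N}$ there exists a constant $c=c(t)$, computable from $t$, such that, for every graph $G$ and every $k\in \mathbb{N}$, either $G$ contains $k$ pairwise vertex-disjoint subgraphs each with pathwidth at least $t + 1$, or $G$ has a vertex subset $X$ of size at most $c\cdot k$ such that $G-X$ has pathwidth at most $t$.
   Context: All graphs are finite, simple, and undirected. A path decomposition of a graph $G$ is a sequence $B_1,\dots,B_p$ of subsets of $V(G)$ (bags) whose union is $V(G)$, such that every edge of $G$ has both ends in some bag, and for every vertex $u$ the indices $i$ with $u\in B_i$ form an interval of consecutive integers. Its width is $\max_i |B_i|-1$. The pathwidth of $G$ is the minimum width of a path decomposition of $G$. *)

theory Defs
  imports Main
begin

subsection \<open>Finite simple graphs\<close>

record 'a ugraph =
  verts :: "'a set"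
  edges :: "'a set set"

definition simple_graph :: "'a ugraph \<Rightarrow> bool" where
  "simple_graph G \<longleftrightarrow> finite (verts G) \<and> (\<forall>e\<in>edges G. e \<subseteq> verts G \<and> card e = 2)"

definition subgraph :: "'a ugraph \<Rightarrow> 'a ugraph \<Rightarrow> bool" where
  "subgraph H G \<longleftrightarrow> simple_graph H \<and> verts H \<subseteq> verts G \<and> edges H \<subseteq> edges G"

definition delete_verts :: "'a ugraph \<Rightarrow> 'a set \<Rightarrow> 'a ugraph" where
  "delete_verts G X = \<lparr>verts = verts G - X, edges = {e \<in> edges G. e \<inter> X = {}}\<rparr>"

subsection \<open>Pathwidth\<close>

text \<open>The bags are required to form a nonempty sequence, so that the maximum in the width
  is taken over a nonempty set.\<close>

definition path_decomposition :: "'a ugraph \<Rightarrow> 'a set list \<Rightarrow> bool" where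
  "path_decomposition G Bs \<longleftrightarrow>
     Bs \<noteq> [] \<and>
     \<Union>(set Bs) = verts G \<and>
     (\<forall>e\<in>edges G. \<exists>B\<in>set Bs. e \<subseteq> B) \<and>
     (\<forall>u\<in>verts G. \<exists>a b. {i. i < length Bs \<and> u \<in> Bs ! i} = {a..b})"

text \<open>Widths are integers because the graph without vertices has pathwidth \<open>-1\<close>.\<close>

definition pd_width :: "'a set list \<Rightarrow> int" where
  "pd_width Bs = int (Max (card ` set Bs)) - 1"

text \<open>For a finite graph the minimum below is attained: the whole vertex set as a single bag
  is a path decomposition, and the widths all lie between \<open>-1\<close> and
  \<open>int (card (verts G)) - 1\<close>.\<close>

definition pathwidth :: "'a ugraph \<Rightarrow> int" where
  "pathwidth G = Min {pd_width Bs | Bs. path_decomposition G Bs}"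

subsection \<open>Computable functions\<close>

text \<open>Kleene's partial recursive functions: \<open>rec_eval r xs y\<close> says that the function
  described by \<open>r\<close> is defined on the argument list \<open>xs\<close> and has value \<open>y\<close> there. The
  recursion variable of \<open>Rec_Prim\<close> and the search variable of \<open>Rec_Min\<close> are the first
  argument.\<close>

datatype recf =
    Rec_Zero
  | Rec_Succ
  | Rec_Proj nat
  | Rec_Comp recf "recf list"
  | Rec_Prim recf recf
  | Rec_Min recf

inductive rec_eval :: "recf \<Rightarrow> nat list \<Rightarrow> nat \<Rightarrow> bool" where
  zero: "rec_eval Rec_Zero xs 0"
| succ: "rec_eval Rec_Succ [x] (Suc x)"
| proj: "i < length xs \<Longrightarrow> rec_eval (Rec_Proj i) xs (xs ! i)"
| comp: "list_all2 (\<lambda>g y. rec_eval g xs y) gs ys \<Longrightarrow> rec_eval f ys z \<Longrightarrow>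
           rec_eval (Rec_Comp f gs) xs z"
| prim_0: "rec_eval f xs y \<Longrightarrow> rec_eval (Rec_Prim f g) (0 # xs) y"
| prim_Suc: "rec_eval (Rec_Prim f g) (n # xs) y \<Longrightarrow> rec_eval g (n # y # xs) z \<Longrightarrow>
               rec_eval (Rec_Prim f g) (Suc n # xs) z"
| min: "rec_eval f (n # xs) 0 \<Longrightarrow> (\<forall>m<n. \<exists>y>0. rec_eval f (m # xs) y) \<Longrightarrow>
          rec_eval (Rec_Min f) xs n"

definition computable :: "(nat \<Rightarrow> nat) \<Rightarrow> bool" where
  "computable f \<longleftrightarrow> (\<exists>r. \<forall>n. rec_eval r [n] (f n))"

inductive_cases rec_eval_elims:
  "rec_eval Rec_Zero xs y"
  "rec_eval Rec_Succ xs y"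
  "rec_eval (Rec_Proj i) xs y"
  "rec_eval (Rec_Comp f gs) xs y"
  "rec_eval (Rec_Prim f g) (0 # xs) y"
  "rec_eval (Rec_Prim f g) (Suc n # xs) y"
  "rec_eval (Rec_Min f) xs y"

lemma rec_eval_deterministic:
  assumes "rec_eval r xs y" "rec_eval r xs z"
  shows "y = z"
  using assms
proof (induction arbitrary: z rule: rec_eval.induct)
  case (comp xs gs ys f w)
  from comp.prems obtain ys' where ys': "list_all2 (\<lambda>g y. rec_eval g xs y) gs ys'"
    "rec_eval f ys' z"
    by (rule rec_eval_elims(4))
  have "ys = ys'"
    using comp.IH(1) ys'(1) by (auto simp: list_all2_conv_all_nth intro: nth_equalityI)
  with comp.IH ys'(2) show ?case by blast
next
  case (prim_Suc f g n xs y w)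
  from prim_Suc.prems obtain y' where "rec_eval (Rec_Prim f g) (n # xs) y'"
    "rec_eval g (n # y' # xs) z"
    by (rule rec_eval_elims(6))
  with prim_Suc.IH show ?case by blast
next
  case (min f n xs)
  from min.prems have z: "rec_eval f (z # xs) 0" "\<forall>m<z. \<exists>y>0. rec_eval f (m # xs) y"
    by (auto elim: rec_eval_elims(7))
  have "\<not> z < n" using min.IH z(1) by fastforce
  moreover have "\<not> n < z" using min.IH(1) z(2) by fastforce
  ultimately show ?case by simp
qed (erule rec_eval_elims; simp)+

end

theory Submission
  imports Defs
begin

text \<open>The linear bound comes from cutting off one wide piece at a time. Call a graph wide if its
  pathwidth exceeds \<open>t\<close>. Suppose that every wide graph \<open>G\<close> has a vertex set \<open>Y\<close> and a
  subset \<open>S\<close> of \<open>Y\<close> of size bounded in terms of \<open>t\<close>, such that \<open>G[Y]\<close> is wide, \<open>G[Y - S]\<close> is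
  not, and every vertex of \<open>Y\<close> with a neighbour outside \<open>Y\<close> lies in \<open>S\<close>
  (\<open>wide_piece_exists\<close>). Then induction on \<open>k\<close> finishes: the piece \<open>G[Y]\<close> extends a packing in
  \<open>G - Y\<close>, and \<open>S\<close> extends a hitting set \<open>X\<close> of \<open>G - Y\<close>, because no edge joins \<open>Y - S\<close> to
  the rest, so that path decompositions of the two sides can be put one after the other.

  The set \<open>Y\<close> comes from the method of Diestel's short proof that graphs of large pathwidth
  contain every forest as a minor. Build up vertex sets one vertex at a time and never let the
  boundary, the set of vertices with a neighbour outside, grow beyond \<open>w = 2 * 3 ^ (t + 1)\<close>
  vertices; the sets so obtained are the sweepable ones. If some sweepable set induces a wide
  graph, take one of minimum size: its boundary together with the last vertex added serves as
  \<open>S\<close>. So it is enough to find any wide sweepable set. If the whole vertex set is sweepable, it is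
  one. Otherwise a sweep cannot be completed, and this allows a tree to grow along its front. Keep a
  sweepable set \<open>X\<close> with exactly \<open>m\<close> boundary vertices that has no sweepable proper superset
  with at most \<open>m\<close> of them, and in \<open>X\<close> a minor model of a tree with \<open>m\<close> nodes, each branch set
  of which reaches the boundary. A new vertex outside \<open>X\<close> next to the boundary becomes a new leaf,
  and then the sweep is pushed as far as \<open>m + 1\<close> boundary vertices allow. By maximality
  of \<open>X\<close>, no set in between has a smaller boundary, so a form of Menger's theorem
  (\<open>linkage_if_boundary_minimal\<close>) provides disjoint connected sets along which all branch sets
  extend to the new boundary (\<open>frontier_extend\<close>, \<open>frontier_tree_model_exists\<close>). Once \<open>w\<close> nodes
  have been placed, the model contains the complete ternary tree of height \<open>t + 1\<close>, and this
  forces pathwidth above \<open>t\<close> (\<open>ternary_large_bag\<close>).\<close>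

section \<open>Boundaries and sweeps\<close>

definition boundary :: "'a set set \<Rightarrow> 'a set \<Rightarrow> 'a set" where
  "boundary E X = {u \<in> X. \<exists>v. v \<notin> X \<and> {u, v} \<in> E}"

lemma boundary_subset: "boundary E X \<subseteq> X"
  by (auto simp: boundary_def)

lemma finite_boundary: "finite X \<Longrightarrow> finite (boundary E X)"
  by (rule finite_subset[OF boundary_subset])

lemma boundary_insert_subset: "boundary E (insert v X) \<subseteq> insert v (boundary E X)"
  by (auto simp: boundary_def)

text \<open>Each vertex is counted on the left at most as often as on the right: a vertex in either
  boundary on the left is in one of those on the right, and a vertex in both has a neighbour
  outside \<open>X \<union> Y\<close> while it lies in \<open>X \<inter> Y\<close>, so it is in both on the right.\<close>

lemma boundary_submodular:
  assumes "finite X" "finite Y"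
  shows "card (boundary E (X \<inter> Y)) + card (boundary E (X \<union> Y))
           \<le> card (boundary E X) + card (boundary E Y)"
proof -
  let ?b = "boundary E"
  have fin: "finite (?b X)" "finite (?b Y)" "finite (?b (X \<inter> Y))" "finite (?b (X \<union> Y))"
    using assms by (auto intro: finite_boundary)
  have "card (?b (X \<inter> Y)) + card (?b (X \<union> Y))
      = card (?b (X \<inter> Y) \<union> ?b (X \<union> Y)) + card (?b (X \<inter> Y) \<inter> ?b (X \<union> Y))"
    using fin by (intro card_Un_Int)
  also have "\<dots> \<le> card (?b X \<union> ?b Y) + card (?b X \<inter> ?b Y)"
    by (intro add_mono card_mono) (use fin in \<open>auto simp: boundary_def\<close>)
  also have "\<dots> = card (?b X) + card (?b Y)"
    using fin by (intro card_Un_Int[symmetric])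
  finally show ?thesis .
qed

text \<open>These are the left parts of partial linear layouts with vertex separation at most \<open>w\<close>. With
  the edges in the boundary taken from the whole graph, they play the role of sets whose induced
  subgraph has a path decomposition of small width ending in a bag that contains the boundary.\<close>

inductive sweepable :: "'a set set \<Rightarrow> 'a set \<Rightarrow> nat \<Rightarrow> 'a set \<Rightarrow> bool"
  for E V w where
  sweepable_empty: "sweepable E V w {}"
| sweepable_insert: "sweepable E V w X \<Longrightarrow> v \<in> V \<Longrightarrow> v \<notin> X \<Longrightarrow>
    card (boundary E (insert v X)) \<le> w \<Longrightarrow> sweepable E V w (insert v X)"

lemma sweepable_subset: "sweepable E V w X \<Longrightarrow> X \<subseteq> V"
  by (induction rule: sweepable.induct) auto

text \<open>Intersecting every set of a sweep of \<open>Y\<close> with \<open>Z\<close> gives a sweep of \<open>Z\<close>: the union of \<open>Z\<close>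
  with a set \<open>U\<close> of the sweep has at least as large a boundary as \<open>Z\<close>, so by submodularity the
  boundary of \<open>Z \<inter> U\<close> is at most that of \<open>U\<close>.\<close>

lemma sweepable_restrict:
  assumes "sweepable E V w Y" "finite V" "Z \<subseteq> Y"
    and min: "\<And>Z'. Z \<subseteq> Z' \<Longrightarrow> Z' \<subseteq> Y \<Longrightarrow> card (boundary E Z) \<le> card (boundary E Z')"
  shows "sweepable E V w Z"
proof -
  have finY: "finite Y"
    using finite_subset[OF sweepable_subset[OF assms(1)] assms(2)] .
  have "sweepable E V w (Z \<inter> U)" if "sweepable E V w U" "U \<subseteq> Y" for U
    using that
  proof (induction rule: sweepable.induct)
    case sweepable_empty
    then show ?case by (simp add: sweepable.sweepable_empty)
  next
    case (sweepable_insert U v)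
    show ?case
    proof (cases "v \<in> Z")
      case True
      let ?U = "insert v U"
      have fin: "finite Z" "finite ?U"
        using finite_subset[OF assms(3) finY] finite_subset[OF sweepable_insert.prems finY] .
      have "card (boundary E (Z \<inter> ?U)) + card (boundary E (Z \<union> ?U))
          \<le> card (boundary E Z) + card (boundary E ?U)"
        using boundary_submodular fin .
      moreover have "card (boundary E Z) \<le> card (boundary E (Z \<union> ?U))"
        using min assms(3) sweepable_insert.prems by blast
      ultimately have "card (boundary E (Z \<inter> ?U)) \<le> w"
        using sweepable_insert.hyps by linarith
      moreover have "Z \<inter> ?U = insert v (Z \<inter> U)" using True by auto
      ultimately show ?thesis
        using sweepable_insert by (auto intro!: sweepable.sweepable_insert)
    next
      case False
      then have "Z \<inter> insert v U = Z \<inter> U" by auto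
      then show ?thesis using sweepable_insert by auto
    qed
  qed
  from this[OF assms(1) order_refl] show ?thesis
    using assms(3) by (simp add: inf_absorb1)
qed

section \<open>Connected sets\<close>

text \<open>Connectedness is stated by cuts instead of walks, because it is used both to glue sets together
  and to find an edge between the two sides of a separation; cuts make both immediate. The empty
  set counts as connected.\<close>

definition conn :: "'a set set \<Rightarrow> 'a set \<Rightarrow> bool" where
  "conn E C \<longleftrightarrow> (\<forall>A. A \<subseteq> C \<longrightarrow> A \<noteq> {} \<longrightarrow> A \<noteq> C \<longrightarrow> (\<exists>a\<in>A. \<exists>b\<in>C - A. {a, b} \<in> E))"

lemma conn_singleton: "conn E {x}"
  by (auto simp: conn_def)

lemma conn_mono: "conn E C \<Longrightarrow> E \<subseteq> E' \<Longrightarrow> conn E' C"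
  unfolding conn_def by blast

lemma conn_Un_edge:
  assumes "conn E C" "conn E D" "a \<in> C" "b \<in> D" "{a, b} \<in> E"
  shows "conn E (C \<union> D)"
  unfolding conn_def
proof (intro allI impI)
  fix A assume A: "A \<subseteq> C \<union> D" "A \<noteq> {}" "A \<noteq> C \<union> D"
  have "A = A \<inter> C \<union> A \<inter> D" using A(1) by blast
  then consider "A \<inter> C \<noteq> {}" "A \<inter> C \<noteq> C" | "A \<inter> D \<noteq> {}" "A \<inter> D \<noteq> D"
    | "A \<inter> C = C" "A \<inter> D = {}" | "A \<inter> C = {}" "A \<inter> D = D"
    using A(2,3) by (metis Un_empty_left)
  then show "\<exists>a\<in>A. \<exists>b\<in>(C \<union> D) - A. {a, b} \<in> E"
  proof cases
    case 1
    then obtain x y where "x \<in> A \<inter> C" "y \<in> C - A \<inter> C" "{x, y} \<in> E"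
      using assms(1)[unfolded conn_def, rule_format, of "A \<inter> C"] by auto
    then show ?thesis by blast
  next
    case 2
    then obtain x y where "x \<in> A \<inter> D" "y \<in> D - A \<inter> D" "{x, y} \<in> E"
      using assms(2)[unfolded conn_def, rule_format, of "A \<inter> D"] by auto
    then show ?thesis by blast
  next
    case 3
    then have "a \<in> A" "b \<in> C \<union> D - A" using assms(3,4) by auto
    then show ?thesis using assms(5) by blast
  next
    case 4
    then have "b \<in> A" "a \<in> C \<union> D - A" using assms(3,4) by auto
    moreover have "{b, a} \<in> E" using assms(5) by (simp add: insert_commute)
    ultimately show ?thesis by blast
  qed
qed

lemma conn_Un_common:
  assumes "conn E C" "conn E D" "a \<in> C" "a \<in> D"
  shows "conn E (C \<union> D)"
  unfolding conn_def
proof (intro allI impI)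
  fix A assume A: "A \<subseteq> C \<union> D" "A \<noteq> {}" "A \<noteq> C \<union> D"
  have "A = A \<inter> C \<union> A \<inter> D" using A(1) by blast
  moreover have "A \<inter> C = {} \<Longrightarrow> A \<inter> D \<noteq> D" "A \<inter> D = {} \<Longrightarrow> A \<inter> C \<noteq> C"
    using assms(3,4) by auto
  ultimately consider "A \<inter> C \<noteq> {}" "A \<inter> C \<noteq> C" | "A \<inter> D \<noteq> {}" "A \<inter> D \<noteq> D"
    using A(2,3) by (metis Un_empty_left)
  then show "\<exists>a\<in>A. \<exists>b\<in>(C \<union> D) - A. {a, b} \<in> E"
  proof cases
    case 1
    then obtain x y where "x \<in> A \<inter> C" "y \<in> C - A \<inter> C" "{x, y} \<in> E"
      using assms(1)[unfolded conn_def, rule_format, of "A \<inter> C"] by auto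
    then show ?thesis by blast
  next
    case 2
    then obtain x y where "x \<in> A \<inter> D" "y \<in> D - A \<inter> D" "{x, y} \<in> E"
      using assms(2)[unfolded conn_def, rule_format, of "A \<inter> D"] by auto
    then show ?thesis by blast
  qed
qed

section \<open>Linking boundaries\<close>

text \<open>A system of disjoint paths from \<open>boundary E X\<close> to \<open>boundary E Y\<close>, relaxed from paths to
  connected sets. Each set meets \<open>X\<close> only in its starting vertex, so it can be added to a branch
  set inside \<open>X\<close> without disturbing the others.\<close>

definition linkage :: "'a set set \<Rightarrow> 'a set \<Rightarrow> 'a set \<Rightarrow> ('a \<Rightarrow> 'a set) \<Rightarrow> bool" where
  "linkage E X Y C \<longleftrightarrow>
     (\<forall>u\<in>boundary E X. u \<in> C u \<and> conn E (C u) \<and> C u \<subseteq> insert u (Y - X)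
        \<and> C u \<inter> boundary E Y \<noteq> {}) \<and>
     (\<forall>u\<in>boundary E X. \<forall>u'\<in>boundary E X. u \<noteq> u' \<longrightarrow> C u \<inter> C u' = {})"

lemma linkageD:
  assumes "linkage E X Y C" "u \<in> boundary E X"
  shows "u \<in> C u" "conn E (C u)" "C u \<subseteq> insert u (Y - X)" "C u \<inter> boundary E Y \<noteq> {}"
    and "u' \<in> boundary E X \<Longrightarrow> u \<noteq> u' \<Longrightarrow> C u \<inter> C u' = {}"
  using assms by (simp_all add: linkage_def)

text \<open>The first system stays inside \<open>Z\<close>, and the second one meets \<open>Z\<close> only in starting vertices, so
  distinct composed sets stay disjoint.\<close>

lemma linkage_trans:
  assumes C: "linkage E X Z C" and D: "linkage E Z Y D" and "X \<subseteq> Z" "Z \<subseteq> Y"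
  shows "\<exists>C. linkage E X Y C"
proof -
  define z where "z u = (SOME x. x \<in> C u \<inter> boundary E Z)" for u
  have "\<exists>x. x \<in> C u \<inter> boundary E Z" if "u \<in> boundary E X" for u
    using linkageD(4)[OF C that] by auto
  then have z: "z u \<in> C u" "z u \<in> boundary E Z" if "u \<in> boundary E X" for u
    using that unfolding z_def by (metis (no_types, lifting) IntD1 IntD2 someI_ex)+
  have CZ: "C u \<subseteq> Z" if "u \<in> boundary E X" for u
    using linkageD(3)[OF C that] subsetD[OF boundary_subset that] assms(3) by auto
  have "linkage E X Y (\<lambda>u. C u \<union> D (z u))"
    unfolding linkage_def
  proof (intro conjI ballI impI)
    fix u assume u: "u \<in> boundary E X"
    note Cu = linkageD[OF C u] and zu = z[OF u] and Du = linkageD[OF D z(2)[OF u]]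
    show "u \<in> C u \<union> D (z u)" using Cu(1) by blast
    show "conn E (C u \<union> D (z u))" using conn_Un_common[OF Cu(2) Du(2) zu(1) Du(1)] .
    show "C u \<union> D (z u) \<subseteq> insert u (Y - X)"
      using Cu(3) Du(3) zu(1) assms(3,4) by blast
    show "(C u \<union> D (z u)) \<inter> boundary E Y \<noteq> {}" using Du(4) by blast
  next
    fix u u' assume u: "u \<in> boundary E X" "u' \<in> boundary E X" "u \<noteq> u'"
    have CC: "C u \<inter> C u' = {}" using linkageD(5)[OF C u] .
    have "z u \<noteq> z u'" using z(1)[OF u(1)] z(1)[OF u(2)] CC by auto
    then have "D (z u) \<inter> D (z u') = {}"
      using linkageD(5)[OF D z(2)[OF u(1)] z(2)[OF u(2)]] by simp
    moreover have "C u \<inter> D (z u') = {}"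
      using CZ[OF u(1)] linkageD(3)[OF D z(2)[OF u(2)]] z(1)[OF u(2)] CC by blast
    moreover have "C u' \<inter> D (z u) = {}"
      using CZ[OF u(2)] linkageD(3)[OF D z(2)[OF u(1)]] z(1)[OF u(1)] CC by blast
    ultimately show "(C u \<union> D (z u)) \<inter> (C u' \<union> D (z u')) = {}" using CC by blast
  qed
  then show ?thesis by blast
qed

text \<open>A form of Menger's theorem, by induction on the number of edges plus \<open>card (Y - X)\<close>. A set
  strictly between \<open>X\<close> and \<open>Y\<close> with as small a boundary as \<open>X\<close> splits the task into two
  smaller ones. If there is none, every set strictly between has at least one boundary vertex to
  spare, so deleting an edge that leaves \<open>X\<close> preserves the hypothesis, unless its end \<open>u\<close> in \<open>X\<close>
  then drops out of the boundary of \<open>X\<close> itself. In that case its other end \<open>v\<close> can replace \<open>u\<close>: adding \<open>v\<close> to \<open>X\<close>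
  does not enlarge the boundary, hence already yields \<open>Y\<close>.\<close>

lemma linkage_if_boundary_minimal:
  assumes "finite E" "finite Y" "X \<subseteq> Y"
    and "\<And>Z. X \<subseteq> Z \<Longrightarrow> Z \<subseteq> Y \<Longrightarrow> card (boundary E X) \<le> card (boundary E Z)"
  shows "\<exists>C. linkage E X Y C"
  using assms
proof (induction "card E + card (Y - X)" arbitrary: E X Y rule: less_induct)
  case less
  note finE = less.prems(1) and finY = less.prems(2) and XY = less.prems(3)
    and min = less.prems(4)
  have fin: "finite Z" if "Z \<subseteq> Y" for Z using that finY finite_subset by blast
  have strictI: "card (boundary E X) < card (boundary E Z)"
    if "\<nexists>Z. X \<subset> Z \<and> Z \<subset> Y \<and> card (boundary E Z) = card (boundary E X)"
       "X \<subset> Z" "Z \<subset> Y" for Z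
  proof -
    have "card (boundary E X) \<le> card (boundary E Z)"
      using min[of Z] that by (simp add: psubset_eq)
    moreover have "card (boundary E Z) \<noteq> card (boundary E X)" using that by blast
    ultimately show ?thesis by linarith
  qed
  consider (tight) Z where "X \<subset> Z" "Z \<subset> Y" "card (boundary E Z) = card (boundary E X)"
    | (sub) "boundary E X \<subseteq> boundary E Y"
    | (strict) u where "u \<in> boundary E X" "u \<notin> boundary E Y"
       "\<And>Z. X \<subset> Z \<Longrightarrow> Z \<subset> Y \<Longrightarrow> card (boundary E X) < card (boundary E Z)"
    using strictI by (metis subsetI)
  then show ?case
  proof cases
    case tight
    have "card (Z - X) < card (Y - X)" "card (Y - Z) < card (Y - X)"
      by (intro psubset_card_mono; use finY tight in auto)+
    moreover have "finite Z" "X \<subseteq> Z" "Z \<subseteq> Y" using tight fin by auto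
    moreover have "card (boundary E Z) \<le> card (boundary E Z')" if "Z \<subseteq> Z'" "Z' \<subseteq> Y" for Z'
      using min[of Z'] that tight by auto
    moreover have "card (boundary E X) \<le> card (boundary E Z')" if "X \<subseteq> Z'" "Z' \<subseteq> Z" for Z'
      using min[of Z'] that tight by auto
    ultimately obtain C D where "linkage E X Z C" "linkage E Z Y D"
      using less.hyps[of E Z X] less.hyps[of E Y Z] finE finY by auto
    then show ?thesis using linkage_trans tight by (metis psubset_imp_subset)
  next
    case sub
    then show ?thesis unfolding linkage_def
      by (intro exI[of _ "\<lambda>u. {u}"]) (auto simp: conn_singleton)
  next
    case strict
    have uX: "u \<in> X" using subsetD[OF boundary_subset strict(1)] .
    obtain v where v: "v \<notin> X" "{u, v} \<in> E" using strict(1) by (auto simp: boundary_def)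
    have vY: "v \<in> Y" using strict(2) subsetD[OF XY uX] v by (auto simp: boundary_def)
    define E' where "E' = E - {{u, v}}"
    \<comment> \<open>Only \<open>u\<close> can leave the boundary of a set containing \<open>X\<close>, since the other end \<open>v\<close> of the
      deleted edge would need its neighbour \<open>u\<close> to be outside.\<close>
    have bd_sub: "boundary E' Z \<subseteq> boundary E Z" for Z
      by (auto simp: boundary_def E'_def)
    have bd_ins: "boundary E Z \<subseteq> insert u (boundary E' Z)" if "X \<subseteq> Z" for Z
      using that uX by (auto simp: boundary_def E'_def doubleton_eq_iff)
    have bd_Y: "boundary E' Y = boundary E Y"
      using uX XY vY by (auto simp: boundary_def E'_def doubleton_eq_iff)
    show ?thesis
    proof (cases "u \<in> boundary E' X")
      case True
      then have bd_X: "boundary E' X = boundary E X"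
        using bd_sub[of X] bd_ins[of X] by auto
      have "card (boundary E' X) \<le> card (boundary E' Z)" if Z: "X \<subseteq> Z" "Z \<subseteq> Y" for Z
      proof -
        consider "Z = X" | "Z = Y" | "X \<subset> Z" "Z \<subset> Y" using Z by blast
        then show ?thesis
        proof cases
          case 3
          have "card (boundary E Z) \<le> card (insert u (boundary E' Z))"
            using bd_ins[OF Z(1)] finite_boundary[OF fin[OF Z(2)], of E'] by (intro card_mono) auto
          also have "\<dots> \<le> Suc (card (boundary E' Z))" by (rule card_insert_le_m1) auto
          finally show ?thesis using strict(3)[OF 3] unfolding bd_X by linarith
        qed (use bd_X bd_Y min XY in auto)
      qed
      moreover have "card E' < card E"
        unfolding E'_def using v finE by (intro card_Diff1_less)
      ultimately obtain C where "linkage E' X Y C"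
        using less.hyps[of E' Y X] finE finY XY by (auto simp: E'_def)
      moreover have "conn E' D \<Longrightarrow> conn E D" for D
        by (erule conn_mono) (auto simp: E'_def)
      ultimately have "linkage E X Y C"
        unfolding linkage_def bd_X bd_Y by simp
      then show ?thesis by blast
    next
      case False
      let ?Z = "insert v X"
      have sub: "boundary E ?Z \<subseteq> insert v (boundary E X - {u})"
        using False by (auto simp: boundary_def E'_def doubleton_eq_iff)
      have finb: "finite (boundary E X)" using finite_boundary[OF fin[OF XY]] .
      have "v \<notin> boundary E X" using v boundary_subset[of E X] by auto
      then have card: "card (insert v (boundary E X - {u})) = card (boundary E X)"
        using finb strict(1) by (simp add: card.insert_remove card_Suc_Diff1 del: card_Diff_insert card_Diff_singleton)
      then have le: "card (boundary E ?Z) \<le> card (boundary E X)"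
        using card_mono[OF _ sub] finb by simp
      have Y: "Y = ?Z"
      proof (rule ccontr)
        assume "Y \<noteq> ?Z"
        then have Z: "X \<subset> ?Z" "?Z \<subset> Y" using v vY XY by auto
        show False using strict(3)[OF Z] le by linarith
      qed
      then have bdY: "boundary E Y = insert v (boundary E X - {u})"
        using sub card min[of Y] finb XY by (intro card_seteq) auto
      have uv: "conn E {u, v}"
        using conn_Un_edge[of E "{u}" "{v}" u v] v by (simp add: conn_singleton insert_commute)
      show ?thesis unfolding linkage_def
        by (intro exI[of _ "\<lambda>x. if x = u then {u, v} else {x}"])
          (use v uX uv vY bdY boundary_subset[of E X] in \<open>auto simp: conn_singleton\<close>)
    qed
  qed
qed

section \<open>Growing a tree along the boundary\<close>

text \<open>The maximality condition is by inclusion and covers all supersets with at most \<open>m\<close> boundary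
  vertices, not just those with exactly \<open>m\<close>; it is what rules out bottlenecks ahead of \<open>X\<close>.\<close>

definition frontier :: "'a set set \<Rightarrow> 'a set \<Rightarrow> nat \<Rightarrow> nat \<Rightarrow> 'a set \<Rightarrow> bool" where
  "frontier E V w m X \<longleftrightarrow> sweepable E V w X \<and> card (boundary E X) = m \<and>
     (\<forall>Z. X \<subset> Z \<longrightarrow> sweepable E V w Z \<longrightarrow> m < card (boundary E Z))"

lemma maximal_sweepable_exists:
  assumes "finite V" "sweepable E V w X" "card (boundary E X) \<le> m"
  obtains Y where "X \<subseteq> Y" "sweepable E V w Y" "card (boundary E Y) \<le> m"
    "\<And>Z. Y \<subset> Z \<Longrightarrow> sweepable E V w Z \<Longrightarrow> m < card (boundary E Z)"
proof -
  let ?A = "{Y. sweepable E V w Y \<and> card (boundary E Y) \<le> m}"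
  have "finite ?A"
    by (rule finite_subset[of _ "Pow V"]) (use assms(1) in \<open>auto dest: sweepable_subset\<close>)
  then obtain Y where Y: "Y \<in> ?A" "X \<subseteq> Y" "\<forall>Z\<in>?A. Y \<subseteq> Z \<longrightarrow> Y = Z"
    using finite_has_maximal2[of ?A X] assms(2,3) by blast
  have "m < card (boundary E Z)" if "Y \<subset> Z" "sweepable E V w Z" for Z
  proof (rule ccontr)
    assume "\<not> m < card (boundary E Z)"
    then have "Z \<in> ?A" using that by simp
    then show False using Y(3) that(1) by blast
  qed
  then show ?thesis using that Y by blast
qed

text \<open>Adding \<open>v\<close> enlarges the boundary by at most one vertex, and by exactly one since \<open>X\<close> is
  maximal. Let \<open>Y\<close> be a maximal sweepable superset with at most \<open>m + 1\<close> boundary vertices. A set of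
  minimum boundary between \<open>X \<union> {v}\<close> and \<open>Y\<close> is sweepable by \<open>sweepable_restrict\<close>, so it has more
  than \<open>m\<close> boundary vertices, again by maximality of \<open>X\<close>. This is the hypothesis of the linking
  lemma.\<close>

lemma frontier_extend:
  assumes "finite E" "finite V" "frontier E V w m X" "m < w" "v \<in> V" "v \<notin> X"
  obtains Y C where "frontier E V w (Suc m) Y" "insert v X \<subseteq> Y"
    "boundary E (insert v X) = insert v (boundary E X)" "linkage E (insert v X) Y C"
proof -
  let ?X = "insert v X"
  have X: "sweepable E V w X" "card (boundary E X) = m"
    and max: "\<And>Z. X \<subset> Z \<Longrightarrow> sweepable E V w Z \<Longrightarrow> m < card (boundary E Z)"
    using assms(3) by (simp_all add: frontier_def)
  have finS: "finite Z" if "sweepable E V w Z" for Z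
    using finite_subset[OF sweepable_subset[OF that] assms(2)] .
  have finb: "finite (boundary E X)" using finite_boundary[OF finS[OF X(1)]] .
  have vb: "v \<notin> boundary E X" using assms(6) boundary_subset[of E X] by auto
  have "card (boundary E ?X) \<le> card (insert v (boundary E X))"
    using boundary_insert_subset[of E v X] finb by (intro card_mono) auto
  then have le: "card (boundary E ?X) \<le> Suc m" using X(2) vb finb by simp
  then have swX: "sweepable E V w ?X"
    using X(1) assms(4-6) by (intro sweepable_insert) auto
  have "m < card (boundary E ?X)" using max[OF _ swX] assms(6) by blast
  with le have cX: "card (boundary E ?X) = Suc m" by simp
  have bX: "boundary E ?X = insert v (boundary E X)"
    using boundary_insert_subset[of E v X] finb vb X(2) cX by (intro card_seteq) auto
  obtain Y where Y: "?X \<subseteq> Y" "sweepable E V w Y" "card (boundary E Y) \<le> Suc m"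
    "\<And>Z. Y \<subset> Z \<Longrightarrow> sweepable E V w Z \<Longrightarrow> Suc m < card (boundary E Z)"
    using maximal_sweepable_exists[OF assms(2) swX le] by metis
  have min: "card (boundary E ?X) \<le> card (boundary E Z)" if "?X \<subseteq> Z" "Z \<subseteq> Y" for Z
  proof -
    define f where "f Z = card (boundary E Z)" for Z
    define Z0 where "Z0 = (ARG_MIN f Z. ?X \<subseteq> Z \<and> Z \<subseteq> Y)"
    have Z0: "?X \<subseteq> Z0" "Z0 \<subseteq> Y"
      and Z0_le: "\<And>Z'. ?X \<subseteq> Z' \<Longrightarrow> Z' \<subseteq> Y \<Longrightarrow> f Z0 \<le> f Z'"
      using arg_min_nat_lemma[of "\<lambda>Z. ?X \<subseteq> Z \<and> Z \<subseteq> Y" Z f] that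
      unfolding Z0_def by auto
    have "card (boundary E Z0) \<le> card (boundary E Z')" if "Z0 \<subseteq> Z'" "Z' \<subseteq> Y" for Z'
      using Z0_le[of Z'] that Z0(1) by (auto simp: f_def)
    then have "sweepable E V w Z0"
      using sweepable_restrict[OF Y(2) assms(2) Z0(2)] by blast
    then have "m < f Z0" using max[of Z0] Z0(1) assms(6) by (auto simp: f_def)
    also have "f Z0 \<le> f Z" using Z0_le that by blast
    finally show ?thesis using cX by (simp add: f_def)
  qed
  then have "card (boundary E Y) = Suc m" using Y(1,3) cX by (metis le_antisym order_refl)
  then have "frontier E V w (Suc m) Y" using Y(2,4) by (simp add: frontier_def)
  moreover obtain C where "linkage E ?X Y C"
    using linkage_if_boundary_minimal[OF assms(1) finS[OF Y(2)] Y(1) min] by blast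
  ultimately show ?thesis using that Y(1) bX by blast
qed

text \<open>A minor model of the tree on \<open>{..<m}\<close> rooted at \<open>0\<close> in which \<open>p i\<close> is the parent of \<open>i\<close>.\<close>

definition tree_model :: "'a set set \<Rightarrow> (nat \<Rightarrow> nat) \<Rightarrow> nat \<Rightarrow> (nat \<Rightarrow> 'a set) \<Rightarrow> bool" where
  "tree_model E p m W \<longleftrightarrow>
     (\<forall>i<m. W i \<noteq> {} \<and> conn E (W i)) \<and>
     (\<forall>i<m. \<forall>j<m. i \<noteq> j \<longrightarrow> W i \<inter> W j = {}) \<and>
     (\<forall>i<m. 0 < i \<longrightarrow> (\<exists>a\<in>W (p i). \<exists>b\<in>W i. {a, b} \<in> E))"

text \<open>There are as many disjoint branch sets as boundary vertices, and each of them contains one. Hence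
  the parent of the next node owns a boundary vertex \<open>r\<close>, and a neighbour \<open>v\<close> of \<open>r\<close> outside \<open>X\<close>
  starts the new branch set. The linkage starts in \<open>v\<close> and in the old boundary vertices, and
  carries the new and the old branch sets to the next boundary.\<close>

lemma frontier_tree_model_exists:
  assumes finE: "finite E" and finV: "finite V" and EV: "\<And>e. e \<in> E \<Longrightarrow> e \<subseteq> V"
    and notV: "\<not> sweepable E V w V" and p: "\<And>i. 0 < i \<Longrightarrow> p i < i" and "m \<le> w"
  shows "\<exists>X W. frontier E V w m X \<and> tree_model E p m W
    \<and> (\<forall>i<m. W i \<subseteq> X \<and> W i \<inter> boundary E X \<noteq> {})"
  using \<open>m \<le> w\<close>
proof (induction m)
  case 0
  obtain X where "sweepable E V w X" "card (boundary E X) \<le> 0"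
    "\<And>Z. X \<subset> Z \<Longrightarrow> sweepable E V w Z \<Longrightarrow> 0 < card (boundary E Z)"
    using maximal_sweepable_exists[OF finV sweepable_empty, of E 0 w]
    by (auto simp: boundary_def)
  then show ?case by (auto simp: frontier_def tree_model_def)
next
  case (Suc m)
  then obtain X W where X: "frontier E V w m X" and W: "tree_model E p m W"
    and WX: "\<And>i. i < m \<Longrightarrow> W i \<subseteq> X" and Wb: "\<And>i. i < m \<Longrightarrow> W i \<inter> boundary E X \<noteq> {}"
    by auto
  have swX: "sweepable E V w X" and cX: "card (boundary E X) = m"
    using X by (simp_all add: frontier_def)
  have WW: "W i \<inter> W j = {}" if "i < m" "j < m" "i \<noteq> j" for i j
    using W that by (simp add: tree_model_def)
  have "\<forall>i\<in>{..<m}. \<exists>u. u \<in> W i \<inter> boundary E X" using Wb by blast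
  then obtain r where r: "\<And>i. i < m \<Longrightarrow> r i \<in> W i \<inter> boundary E X"
    by (metis lessThan_iff)
  \<comment> \<open>The root has no parent, so for \<open>m = 0\<close> any vertex outside \<open>X\<close> will do; there is one because
    \<open>V\<close> is not sweepable.\<close>
  have "\<exists>v. v \<in> V - X \<and> (0 < m \<longrightarrow> {r (p m), v} \<in> E)"
  proof (cases "m = 0")
    case True
    have "X \<noteq> V" using swX notV by auto
    then show ?thesis using sweepable_subset[OF swX] True by blast
  next
    case False
    then have "r (p m) \<in> boundary E X" using r p by blast
    then show ?thesis using EV by (fastforce simp: boundary_def)
  qed
  then obtain v where v: "v \<in> V" "v \<notin> X" "0 < m \<Longrightarrow> {r (p m), v} \<in> E" by blast
  obtain Y C where Y: "frontier E V w (Suc m) Y" "insert v X \<subseteq> Y"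
    and b: "boundary E (insert v X) = insert v (boundary E X)"
    and C: "linkage E (insert v X) Y C"
    using frontier_extend[OF finE finV X _ v(1,2)] Suc.prems by auto
  define u where "u i = (if i = m then v else r i)" for i
  define W' where "W' i = (if i = m then C v else W i \<union> C (r i))" for i
  have vX: "v \<notin> boundary E X" using v(2) boundary_subset[of E X] by auto
  have u: "u i \<in> boundary E (insert v X)" if "i < Suc m" for i
    using r[of i] that unfolding b u_def by auto
  have u_ne: "u i \<noteq> u j" if "i < Suc m" "j < Suc m" "i \<noteq> j" for i j
    using r[of i] r[of j] WW[of i j] that vX unfolding u_def by (auto split: if_splits)
  note Cu = linkageD[OF C u]
  have CC: "C (u i) \<inter> C (u j) = {}" if "i < Suc m" "j < Suc m" "i \<noteq> j" for i j
    using Cu(5)[OF that(1) u[OF that(2)] u_ne[OF that]] .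
  have W'_alt: "W' i = C (u i) \<union> (if i = m then {} else W i)" for i
    by (auto simp: W'_def u_def)
  have WC: "W i \<inter> C (u j) = {}" if "i < m" "j < Suc m" "i \<noteq> j" for i j
  proof -
    have "u j \<notin> W i" using r[of j] WX[of i] WW[of i j] v(2) that by (auto simp: u_def)
    then show ?thesis using Cu(3)[OF that(2)] WX[OF that(1)] by blast
  qed
  have "W' i \<inter> W' j = {}" if "i < Suc m" "j < Suc m" "i \<noteq> j" for i j
    using CC[OF that] WC[of i j] WC[of j i] WW[of i j] that
    unfolding W'_alt by (auto split: if_splits)
  moreover have "W' i \<noteq> {}" if "i < Suc m" for i
    using Cu(1)[OF that] by (auto simp: W'_alt)
  moreover have "conn E (W' i)" if "i < Suc m" for i
  proof (cases "i = m")
    case True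
    then show ?thesis using Cu(2)[OF that] by (simp add: W'_alt)
  next
    case False
    then have "conn E (W i)" "r i \<in> W i" "u i = r i"
      using W r[of i] that by (auto simp: tree_model_def u_def)
    then show ?thesis
      using conn_Un_common[of E "C (u i)" "W i" "r i"] Cu(1,2)[OF that] False
      by (simp add: W'_alt)
  qed
  moreover have "\<exists>a\<in>W' (p i). \<exists>b\<in>W' i. {a, b} \<in> E" if "i < Suc m" "0 < i" for i
  proof (cases "i = m")
    case True
    then have "p i < m" using p that by blast
    then have "r (p i) \<in> W' (p i)" using r by (auto simp: W'_def)
    moreover have "v \<in> W' i" using Cu(1)[OF that(1)] True by (simp add: W'_alt u_def)
    ultimately show ?thesis using v(3) that True by blast
  next
    case False
    then have "i < m" "p i < m" using p[of i] that by auto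
    moreover have "\<exists>a\<in>W (p i). \<exists>b\<in>W i. {a, b} \<in> E"
      using W \<open>i < m\<close> that(2) by (simp add: tree_model_def)
    ultimately show ?thesis by (auto simp: W'_alt)
  qed
  ultimately have "tree_model E p (Suc m) W'" by (simp add: tree_model_def)
  moreover have "W' i \<subseteq> Y \<and> W' i \<inter> boundary E Y \<noteq> {}" if "i < Suc m" for i
  proof
    have "u i \<in> insert v X" using subsetD[OF boundary_subset u[OF that]] .
    then have "C (u i) \<subseteq> Y" using Cu(3)[OF that] Y(2) by blast
    moreover have "i \<noteq> m \<Longrightarrow> W i \<subseteq> Y" using WX[of i] Y(2) that by auto
    ultimately show "W' i \<subseteq> Y" by (auto simp: W'_alt)
    show "W' i \<inter> boundary E Y \<noteq> {}" using Cu(4)[OF that] by (auto simp: W'_alt)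
  qed
  ultimately show ?case using Y(1) by blast
qed

section \<open>Path decompositions of induced subgraphs\<close>

lemma convex_nat_set_iff_interval:
  fixes I :: "nat set"
  assumes "finite I"
  shows "(\<exists>a b. I = {a..b}) \<longleftrightarrow> (\<forall>i j k. i \<le> j \<longrightarrow> j \<le> k \<longrightarrow> i \<in> I \<longrightarrow> k \<in> I \<longrightarrow> j \<in> I)"
    (is "_ \<longleftrightarrow> ?convex")
proof
  assume ?convex
  show "\<exists>a b. I = {a..b}"
  proof (cases "I = {}")
    case True
    then have "I = {1..0}" by simp
    then show ?thesis by blast
  next
    case False
    then have "Min I \<in> I" "Max I \<in> I" using assms by simp_all
    then have "I = {Min I..Max I}"
      using \<open>?convex\<close> assms by (auto intro: Min_le Max_ge)
    then show ?thesis by blast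
  qed
qed auto

text \<open>Betweenness of indices replaces the interval condition, and it is required of all \<open>u\<close>; the
  empty index set of a vertex in no bag is an interval with crossed ends.\<close>

lemma path_decomposition_iff:
  "path_decomposition G Bs \<longleftrightarrow> Bs \<noteq> [] \<and> \<Union>(set Bs) = verts G \<and>
     (\<forall>e\<in>edges G. \<exists>i<length Bs. e \<subseteq> Bs ! i) \<and>
     (\<forall>u i j k. i \<le> j \<longrightarrow> j \<le> k \<longrightarrow> k < length Bs \<longrightarrow> u \<in> Bs ! i \<longrightarrow> u \<in> Bs ! k \<longrightarrow> u \<in> Bs ! j)"
    (is "_ \<longleftrightarrow> ?ne \<and> ?cover \<and> ?edges \<and> ?convex")
proof -
  have edges: "(\<forall>e\<in>edges G. \<exists>B\<in>set Bs. e \<subseteq> B) \<longleftrightarrow> ?edges"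
    by (metis in_set_conv_nth)
  have interval: "(\<exists>a b. {i. i < length Bs \<and> u \<in> Bs ! i} = {a..b}) \<longleftrightarrow>
      (\<forall>i j k. i \<le> j \<longrightarrow> j \<le> k \<longrightarrow> k < length Bs \<longrightarrow> u \<in> Bs ! i \<longrightarrow> u \<in> Bs ! k \<longrightarrow> u \<in> Bs ! j)" for u
  proof -
    have "finite {i. i < length Bs \<and> u \<in> Bs ! i}" by simp
    then show ?thesis
      unfolding convex_nat_set_iff_interval[OF \<open>finite _\<close>] mem_Collect_eq
      by (meson le_less_trans le_trans)
  qed
  have conv: "(\<forall>u\<in>verts G. \<exists>a b. {i. i < length Bs \<and> u \<in> Bs ! i} = {a..b}) \<longleftrightarrow> ?convex"
    if cover: "\<Union>(set Bs) = verts G"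
  proof -
    have "u \<in> verts G" if "i < length Bs" "u \<in> Bs ! i" for u i
      using cover that by auto
    then show ?thesis unfolding interval by blast
  qed
  show ?thesis
    unfolding path_decomposition_def edges by (intro conj_cong[OF refl] conv)
qed

lemma path_decompositionD:
  assumes "path_decomposition G Bs"
  shows "Bs \<noteq> []" "\<Union>(set Bs) = verts G" "i < length Bs \<Longrightarrow> Bs ! i \<subseteq> verts G"
    and "e \<in> edges G \<Longrightarrow> \<exists>i<length Bs. e \<subseteq> Bs ! i"
    and "i \<le> j \<Longrightarrow> j \<le> k \<Longrightarrow> k < length Bs \<Longrightarrow> u \<in> Bs ! i \<Longrightarrow> u \<in> Bs ! k \<Longrightarrow> u \<in> Bs ! j"
proof -
  note pd = assms[unfolded path_decomposition_iff]
  show "Bs \<noteq> []" using pd by (rule conjunct1)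
  show cover: "\<Union>(set Bs) = verts G" using pd by (elim conjE)
  show "i < length Bs \<Longrightarrow> Bs ! i \<subseteq> verts G" using cover nth_mem[of i Bs] by blast
  have edges: "\<forall>e\<in>edges G. \<exists>i<length Bs. e \<subseteq> Bs ! i" using pd by (elim conjE)
  show "e \<in> edges G \<Longrightarrow> \<exists>i<length Bs. e \<subseteq> Bs ! i" using edges by (rule bspec)
  have "\<forall>u i j k. i \<le> j \<longrightarrow> j \<le> k \<longrightarrow> k < length Bs \<longrightarrow> u \<in> Bs ! i \<longrightarrow> u \<in> Bs ! k \<longrightarrow> u \<in> Bs ! j"
    using pd by (elim conjE)
  then show "i \<le> j \<Longrightarrow> j \<le> k \<Longrightarrow> k < length Bs \<Longrightarrow> u \<in> Bs ! i \<Longrightarrow> u \<in> Bs ! k \<Longrightarrow> u \<in> Bs ! j"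
    by simp
qed

text \<open>The number \<open>s\<close> bounds the sizes of the bags, hence is one more than the width.\<close>

definition narrow :: "'a ugraph \<Rightarrow> nat \<Rightarrow> bool" where
  "narrow G s \<longleftrightarrow> (\<exists>Bs. path_decomposition G Bs \<and> (\<forall>B\<in>set Bs. card B \<le> s))"

lemma pathwidth_le_iff_narrow:
  assumes "simple_graph G"
  shows "pathwidth G \<le> int t \<longleftrightarrow> narrow G (Suc t)"
proof -
  let ?S = "{pd_width Bs | Bs. path_decomposition G Bs}"
  have fin: "finite (verts G)" and E: "\<And>e. e \<in> edges G \<Longrightarrow> e \<subseteq> verts G"
    using assms by (auto simp: simple_graph_def)
  have "?S \<subseteq> {- 1..int (card (verts G)) - 1}"
  proof
    fix x assume "x \<in> ?S"
    then obtain Bs where Bs: "x = pd_width Bs" "path_decomposition G Bs" by blast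
    have "card B \<le> card (verts G)" if "B \<in> set Bs" for B
      using Bs(2) that fin by (auto simp: path_decomposition_def intro!: card_mono)
    moreover have "Bs \<noteq> []" using Bs(2) by (simp add: path_decomposition_def)
    ultimately have "Max (card ` set Bs) \<le> card (verts G)" by simp
    then show "x \<in> {- 1..int (card (verts G)) - 1}"
      using Bs(1) by (simp add: pd_width_def)
  qed
  then have finS: "finite ?S" using finite_subset by blast
  have "path_decomposition G [verts G]"
    using E by (auto simp: path_decomposition_iff)
  then have "?S \<noteq> {}" by blast
  with finS have "pathwidth G \<le> int t \<longleftrightarrow> (\<exists>x\<in>?S. x \<le> int t)"
    unfolding pathwidth_def by (simp add: Min_le_iff)
  also have "\<dots> \<longleftrightarrow> (\<exists>Bs. path_decomposition G Bs \<and> pd_width Bs \<le> int t)" by blast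
  also have "\<dots> \<longleftrightarrow> narrow G (Suc t)"
  proof -
    have "pd_width Bs \<le> int t \<longleftrightarrow> (\<forall>B\<in>set Bs. card B \<le> Suc t)"
      if "path_decomposition G Bs" for Bs
    proof -
      have "Bs \<noteq> []" using that by (simp add: path_decomposition_def)
      have "pd_width Bs \<le> int t \<longleftrightarrow> Max (card ` set Bs) \<le> Suc t"
        unfolding pd_width_def by linarith
      then show ?thesis using \<open>Bs \<noteq> []\<close> by simp
    qed
    then show ?thesis unfolding narrow_def by blast
  qed
  finally show ?thesis .
qed

definition induced :: "'a set set \<Rightarrow> 'a set \<Rightarrow> 'a ugraph" where
  "induced E Y = \<lparr>verts = Y, edges = {e \<in> E. e \<subseteq> Y}\<rparr>"

lemma verts_induced [simp]: "verts (induced E Y) = Y"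
  and edges_induced [simp]: "edges (induced E Y) = {e \<in> E. e \<subseteq> Y}"
  by (simp_all add: induced_def)

lemma narrow_subset:
  assumes "narrow (induced E Y) s" "X \<subseteq> Y" "finite Y"
  shows "narrow (induced E X) s"
proof -
  obtain Bs where Bs: "path_decomposition (induced E Y) Bs" "\<And>B. B \<in> set Bs \<Longrightarrow> card B \<le> s"
    using assms(1) by (auto simp: narrow_def)
  have fin: "finite B" if "B \<in> set Bs" for B
    using path_decompositionD(2)[OF Bs(1)] that assms(3) by (auto intro: finite_subset)
  let ?Cs = "map (\<lambda>B. B \<inter> X) Bs"
  have "path_decomposition (induced E X) ?Cs"
    unfolding path_decomposition_iff
  proof (intro conjI ballI)
    show "?Cs \<noteq> []" using path_decompositionD(1)[OF Bs(1)] by simp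
    show "\<Union> (set ?Cs) = verts (induced E X)"
      using path_decompositionD(2)[OF Bs(1)] assms(2) by auto
    show "\<exists>i<length ?Cs. e \<subseteq> ?Cs ! i" if "e \<in> edges (induced E X)" for e
    proof -
      have "e \<in> edges (induced E Y)" using that assms(2) by auto
      then obtain i where "i < length Bs" "e \<subseteq> Bs ! i"
        using path_decompositionD(4)[OF Bs(1)] by blast
      then show ?thesis using that by (intro exI[of _ i]) auto
    qed
    show "\<forall>u i j k. i \<le> j \<longrightarrow> j \<le> k \<longrightarrow> k < length ?Cs \<longrightarrow> u \<in> ?Cs ! i
        \<longrightarrow> u \<in> ?Cs ! k \<longrightarrow> u \<in> ?Cs ! j"
      using path_decompositionD(5)[OF Bs(1)] by simp
  qed
  moreover have "card B \<le> s" if "B \<in> set ?Cs" for B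
    using that Bs(2) fin by (auto intro: order_trans[OF card_mono[OF _ Int_lower1]])
  ultimately show ?thesis unfolding narrow_def by blast
qed

lemma narrow_Un:
  assumes "narrow (induced E X) s" "narrow (induced E Y) s" "X \<inter> Y = {}"
    and sep: "\<And>e. e \<in> E \<Longrightarrow> e \<subseteq> X \<union> Y \<Longrightarrow> e \<subseteq> X \<or> e \<subseteq> Y"
  shows "narrow (induced E (X \<union> Y)) s"
proof -
  obtain Bs where Bs: "path_decomposition (induced E X) Bs" "\<And>B. B \<in> set Bs \<Longrightarrow> card B \<le> s"
    using assms(1) by (auto simp: narrow_def)
  obtain Cs where Cs: "path_decomposition (induced E Y) Cs" "\<And>B. B \<in> set Cs \<Longrightarrow> card B \<le> s"
    using assms(2) by (auto simp: narrow_def)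
  have X: "Bs ! i \<subseteq> X" if "i < length Bs" for i
    using path_decompositionD(3)[OF Bs(1) that] by simp
  have Y: "Cs ! i \<subseteq> Y" if "i < length Cs" for i
    using path_decompositionD(3)[OF Cs(1) that] by simp
  have "path_decomposition (induced E (X \<union> Y)) (Bs @ Cs)"
    unfolding path_decomposition_iff
  proof (intro conjI ballI allI impI)
    show "Bs @ Cs \<noteq> []" using path_decompositionD(1)[OF Bs(1)] by simp
    show "\<Union> (set (Bs @ Cs)) = verts (induced E (X \<union> Y))"
      using path_decompositionD(2)[OF Bs(1)] path_decompositionD(2)[OF Cs(1)] by simp
    show "\<exists>i<length (Bs @ Cs). e \<subseteq> (Bs @ Cs) ! i" if e: "e \<in> edges (induced E (X \<union> Y))" for e
    proof -
      have "e \<in> edges (induced E X) \<or> e \<in> edges (induced E Y)" using sep e by auto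
      then have "\<exists>B\<in>set (Bs @ Cs). e \<subseteq> B"
        using path_decompositionD(4)[OF Bs(1), of e] path_decompositionD(4)[OF Cs(1), of e]
        by (metis in_set_conv_nth in_set_conv_decomp set_append UnI1 UnI2)
      then show ?thesis by (metis in_set_conv_nth)
    qed
    fix u i j k
    assume ijk: "i \<le> j" "j \<le> k" "k < length (Bs @ Cs)" "u \<in> (Bs @ Cs) ! i" "u \<in> (Bs @ Cs) ! k"
    consider "k < length Bs" | "length Bs \<le> i" | "i < length Bs" "length Bs \<le> k" by linarith
    then show "u \<in> (Bs @ Cs) ! j"
    proof cases
      case 1
      then have "u \<in> Bs ! i" "u \<in> Bs ! k" using ijk by (auto simp: nth_append)
      then have "u \<in> Bs ! j" using path_decompositionD(5)[OF Bs(1) ijk(1,2) 1] by blast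
      then show ?thesis using 1 ijk by (simp add: nth_append)
    next
      case 2
      let ?n = "length Bs"
      have "i - ?n \<le> j - ?n" "j - ?n \<le> k - ?n" "k - ?n < length Cs"
        "u \<in> Cs ! (i - ?n)" "u \<in> Cs ! (k - ?n)"
        using 2 ijk by (auto simp: nth_append)
      then have "u \<in> Cs ! (j - ?n)" by (rule path_decompositionD(5)[OF Cs(1)])
      then show ?thesis using 2 ijk by (simp add: nth_append)
    next
      case 3
      then have "k - length Bs < length Cs" "u \<in> Bs ! i" "u \<in> Cs ! (k - length Bs)"
        using ijk by (auto simp: nth_append)
      then have "u \<in> X" "u \<in> Y" using X[OF 3(1)] Y by blast+
      then show ?thesis using assms(3) by blast
    qed
  qed
  moreover have "card B \<le> s" if "B \<in> set (Bs @ Cs)" for B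
    using that Bs(2) Cs(2) by auto
  ultimately show ?thesis unfolding narrow_def by blast
qed

text \<open>If the middle bag missed \<open>C\<close>, then the vertices of \<open>C\<close> in earlier bags would be a proper
  nonempty part of \<open>C\<close>, and the bag containing an edge that leaves this part would lie neither
  before nor after the middle one.\<close>

lemma conn_meets_middle_bag:
  assumes "conn E C" "C \<subseteq> Y" and Bs: "path_decomposition (induced E Y) Bs"
    and "i \<le> j" "j \<le> k" "k < length Bs" "Bs ! i \<inter> C \<noteq> {}" "Bs ! k \<inter> C \<noteq> {}"
  shows "Bs ! j \<inter> C \<noteq> {}"
proof
  assume j: "Bs ! j \<inter> C = {}"
  have convex: "u \<in> Bs ! m" if "l \<le> m" "m \<le> n" "n < length Bs" "u \<in> Bs ! l" "u \<in> Bs ! n" for u l m n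
    using path_decompositionD(5)[OF Bs that] .
  define A where "A = {u \<in> C. \<exists>l<j. u \<in> Bs ! l}"
  have "i < j" using j assms(4,7) by (cases "i = j") auto
  then have "A \<noteq> {}" using assms(7) unfolding A_def by blast
  moreover obtain x where x: "x \<in> Bs ! k" "x \<in> C" using assms(8) by blast
  have "x \<notin> A"
  proof
    assume "x \<in> A"
    then obtain l where "l < j" "x \<in> Bs ! l" by (auto simp: A_def)
    then have "x \<in> Bs ! j" using convex[of l j k x] x assms(5,6) by simp
    then show False using j x by blast
  qed
  with x have "A \<noteq> C" by blast
  moreover have "A \<subseteq> C" by (auto simp: A_def)
  ultimately obtain a b where ab: "a \<in> A" "b \<in> C - A" "{a, b} \<in> E"
    using assms(1) unfolding conn_def by blast
  then have "{a, b} \<in> edges (induced E Y)" using assms(2) by (auto simp: A_def)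
  then obtain l where l: "l < length Bs" "{a, b} \<subseteq> Bs ! l"
    using path_decompositionD(4)[OF Bs] by blast
  have "\<not> l < j" using ab(2) l(2) by (auto simp: A_def)
  obtain m where "m < j" "a \<in> Bs ! m" "a \<in> C" using ab(1) by (auto simp: A_def)
  then have "a \<in> Bs ! j" using convex[of m j l a] l \<open>\<not> l < j\<close> by simp
  then show False using j \<open>a \<in> C\<close> by blast
qed

section \<open>Ternary trees have large pathwidth\<close>

text \<open>The vertex set of a minor model of the complete ternary tree of height \<open>h\<close>: \<open>C\<close> is the branch
  set of the root and \<open>S 0\<close>, \<open>S 1\<close>, \<open>S 2\<close> carry the subtrees below it.\<close>

primrec ternary :: "'a set set \<Rightarrow> nat \<Rightarrow> 'a set \<Rightarrow> bool" where
  "ternary E 0 T \<longleftrightarrow> T \<noteq> {} \<and> conn E T"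
| "ternary E (Suc h) T \<longleftrightarrow> (\<exists>C (S :: nat \<Rightarrow> 'a set). T = C \<union> (\<Union>i<3. S i) \<and> conn E C \<and>
     (\<forall>i<3. ternary E h (S i) \<and> C \<inter> S i = {} \<and> (\<exists>a\<in>C. \<exists>b\<in>S i. {a, b} \<in> E)) \<and>
     (\<forall>i<3. \<forall>j<3. i \<noteq> j \<longrightarrow> S i \<inter> S j = {}))"

lemma conn_star:
  assumes "finite I" "conn E C"
    and "\<And>i. i \<in> I \<Longrightarrow> conn E (S i)" "\<And>i. i \<in> I \<Longrightarrow> \<exists>a\<in>C. \<exists>b\<in>S i. {a, b} \<in> E"
  shows "conn E (C \<union> (\<Union>i\<in>I. S i))"
  using assms(1,3,4)
proof (induction I)
  case empty
  then show ?case using assms(2) by simp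
next
  case (insert i I)
  obtain a b where "a \<in> C" "b \<in> S i" "{a, b} \<in> E" using insert.prems(2) by blast
  then have "conn E ((C \<union> (\<Union>i\<in>I. S i)) \<union> S i)"
    using insert conn_Un_edge[of E "C \<union> (\<Union>i\<in>I. S i)" "S i" a b] by simp
  moreover have "(C \<union> (\<Union>i\<in>I. S i)) \<union> S i = C \<union> (\<Union>i\<in>insert i I. S i)" by blast
  ultimately show ?case by simp
qed

lemma ternary_conn: "ternary E h T \<Longrightarrow> conn E T"
proof (induction h arbitrary: T)
  case (Suc h)
  then obtain C and S :: "nat \<Rightarrow> 'a set" where "T = C \<union> (\<Union>i<3. S i)" "conn E C"
    "\<And>i. i < 3 \<Longrightarrow> ternary E h (S i)" "\<And>i. i < 3 \<Longrightarrow> \<exists>a\<in>C. \<exists>b\<in>S i. {a, b} \<in> E"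
    by auto
  then show ?case using conn_star[of "{..<3::nat}" E C S] Suc.IH by auto
qed simp

lemma sort_three:
  fixes f :: "nat \<Rightarrow> nat"
  obtains a b c where "a < 3" "b < 3" "c < 3" "a \<noteq> b" "c \<noteq> b" "f a \<le> f b" "f b \<le> f c"
proof -
  consider "f 0 \<le> f 1" "f 1 \<le> f 2" | "f 0 \<le> f 2" "f 2 \<le> f 1" | "f 1 \<le> f 0" "f 0 \<le> f 2"
    | "f 1 \<le> f 2" "f 2 \<le> f 0" | "f 2 \<le> f 0" "f 0 \<le> f 1" | "f 2 \<le> f 1" "f 1 \<le> f 0"
    by linarith
  then show ?thesis
    by cases (rule that[of 0 1 2] that[of 0 2 1] that[of 1 0 2] that[of 1 2 0]
        that[of 2 0 1] that[of 2 1 0]; simp)+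
qed

text \<open>By induction each of the three subtrees has a bag with at least \<open>h + 1\<close> of its vertices. Let
  \<open>b\<close> be the subtree whose bag is in the middle. The other two subtrees together with the root branch set
  are connected and meet a bag on each side, so they meet the middle bag as well,
  which thus contains a vertex of \<open>T\<close> outside subtree \<open>b\<close>.\<close>

lemma ternary_large_bag:
  assumes "ternary E h T" "finite T" "T \<subseteq> Y" and Bs: "path_decomposition (induced E Y) Bs"
  shows "\<exists>i<length Bs. Suc h \<le> card (Bs ! i \<inter> T)"
  using assms(1-3)
proof (induction h arbitrary: T)
  case 0
  then obtain x where x: "x \<in> T" by auto
  have "x \<in> \<Union> (set Bs)" using x 0 path_decompositionD(2)[OF Bs] by auto
  then obtain i where "i < length Bs" "x \<in> Bs ! i" by (auto simp: in_set_conv_nth)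
  moreover have "card (Bs ! i \<inter> T) \<noteq> 0" using x 0 \<open>x \<in> Bs ! i\<close> by auto
  ultimately show ?case by (metis Suc_leI neq0_conv)
next
  case (Suc h)
  then obtain C and S :: "nat \<Rightarrow> 'a set" where T: "T = C \<union> (\<Union>i<3. S i)" and C: "conn E C"
    and S: "\<And>i. i < 3 \<Longrightarrow> ternary E h (S i)" "\<And>i. i < 3 \<Longrightarrow> C \<inter> S i = {}"
      "\<And>i. i < 3 \<Longrightarrow> \<exists>a\<in>C. \<exists>b\<in>S i. {a, b} \<in> E"
      "\<And>i j. i < 3 \<Longrightarrow> j < 3 \<Longrightarrow> i \<noteq> j \<Longrightarrow> S i \<inter> S j = {}"
    by auto
  have ST: "S i \<subseteq> T" if "i < 3" for i using that T by blast
  have "\<forall>i\<in>{..<3}. \<exists>l<length Bs. Suc h \<le> card (Bs ! l \<inter> S i)"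
  proof
    fix i :: nat assume "i \<in> {..<3}"
    then have "i < 3" by simp
    show "\<exists>l<length Bs. Suc h \<le> card (Bs ! l \<inter> S i)"
      using Suc.IH[OF S(1)[OF \<open>i < 3\<close>]] ST[OF \<open>i < 3\<close>] Suc.prems(2,3) finite_subset by fast
  qed
  then obtain f where f: "\<And>i. i < 3 \<Longrightarrow> f i < length Bs \<and> Suc h \<le> card (Bs ! f i \<inter> S i)"
    by (metis lessThan_iff)
  obtain a b c where abc: "a < 3" "b < 3" "c < 3" "a \<noteq> b" "c \<noteq> b" "f a \<le> f b" "f b \<le> f c"
    by (rule sort_three)
  let ?D = "C \<union> (\<Union>i\<in>{a, c}. S i)"
  have D: "conn E ?D"
    by (rule conn_star) (use C S(3) abc ternary_conn[OF S(1)] in auto)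
  have DT: "?D \<subseteq> T" using T ST abc by blast
  have ne: "Bs ! f i \<inter> S i \<noteq> {}" if "i < 3" for i using f[OF that] by auto
  have "Bs ! f b \<inter> ?D \<noteq> {}"
  proof (rule conn_meets_middle_bag[OF D _ Bs abc(6,7)])
    show "?D \<subseteq> Y" using DT Suc.prems(3) by (rule subset_trans)
    show "f c < length Bs" using f[OF abc(3)] by simp
    show "Bs ! f a \<inter> ?D \<noteq> {}" "Bs ! f c \<inter> ?D \<noteq> {}" using ne[OF abc(1)] ne[OF abc(3)] by auto
  qed
  then obtain x where x: "x \<in> Bs ! f b" "x \<in> ?D" by blast
  have "x \<notin> S b" using x(2) S(2)[OF abc(2)] S(4)[of a b] S(4)[of c b] abc by auto
  have "Suc (Suc h) \<le> Suc (card (Bs ! f b \<inter> S b))" using f[OF abc(2)] by simp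
  also have "\<dots> = card (insert x (Bs ! f b \<inter> S b))"
    using \<open>x \<notin> S b\<close> finite_subset[OF ST[OF abc(2)] Suc.prems(2)] by simp
  also have "\<dots> \<le> card (Bs ! f b \<inter> T)"
    by (rule card_mono) (use x DT ST[OF abc(2)] Suc.prems(2) in auto)
  finally show ?case using f[OF abc(2)] by blast
qed

text \<open>The breadth-first numbering of the infinite ternary tree: the children of \<open>i\<close> are \<open>3 * i + 1\<close>,
  \<open>3 * i + 2\<close> and \<open>3 * i + 3\<close>. The value at the root \<open>0\<close> is \<open>0\<close> by truncated subtraction.\<close>

definition parent :: "nat \<Rightarrow> nat" where
  "parent i = (i - 1) div 3"

primrec descendants :: "nat \<Rightarrow> nat \<Rightarrow> nat set" where
  "descendants 0 i = {i}"
| "descendants (Suc h) i = insert i (\<Union>k<3. descendants h (3 * i + 1 + k))"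

lemma parent_child: "k < 3 \<Longrightarrow> parent (3 * i + 1 + k) = i"
  by (simp add: parent_def)

lemma descendants_root: "i \<in> descendants h i"
  by (cases h) auto

lemma descendants_ge: "j \<in> descendants h i \<Longrightarrow> i \<le> j"
  by (induction h arbitrary: i) fastforce+

text \<open>The shift by \<open>2\<close> absorbs the offset in the largest child: \<open>3 * i + 3 + 2 \<le> 3 * (i + 2)\<close>.\<close>

lemma descendants_bound: "j \<in> descendants h i \<Longrightarrow> j + 2 \<le> 3 ^ h * (i + 2)"
proof (induction h arbitrary: i)
  case (Suc h)
  show ?case
  proof (cases "j = i")
    case True
    have "1 * (i + 2) \<le> 3 ^ Suc h * (i + 2)" by (intro mult_le_mono1) simp
    then show ?thesis using True by simp
  next
    case False
    then obtain k where k: "k < 3" "j \<in> descendants h (3 * i + 1 + k)" using Suc.prems by auto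
    then have "j + 2 \<le> 3 ^ h * (3 * i + 1 + k + 2)" using Suc.IH by blast
    also have "\<dots> \<le> 3 ^ h * (3 * (i + 2))" using k(1) by (intro mult_le_mono2) simp
    finally show ?thesis by (simp add: algebra_simps)
  qed
qed simp

lemma descendants_ancestor: "j \<in> descendants h i \<Longrightarrow> \<exists>l. (parent ^^ l) j = i"
proof (induction h arbitrary: i)
  case 0
  then show ?case by (auto intro: exI[of _ 0])
next
  case (Suc h)
  show ?case
  proof (cases "j = i")
    case True
    then show ?thesis by (auto intro: exI[of _ 0])
  next
    case False
    then obtain k where k: "k < 3" "j \<in> descendants h (3 * i + 1 + k)" using Suc.prems by auto
    then obtain l where "(parent ^^ l) j = 3 * i + 1 + k" using Suc.IH by blast
    then have "(parent ^^ Suc l) j = i" using parent_child[OF k(1)] by simp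
    then show ?thesis by blast
  qed
qed

lemma parent_funpow_le: "(parent ^^ l) i \<le> i"
proof (induction l)
  case (Suc l)
  have "parent ((parent ^^ l) i) \<le> (parent ^^ l) i" by (simp add: parent_def)
  then show ?case using Suc by simp
qed simp

text \<open>The ancestors of a common descendant form a chain, so one of the two siblings would be a proper
  ancestor of the other, and thus at most their common parent \<open>i\<close>.\<close>

lemma descendants_siblings_disjoint:
  assumes "k < 3" "k' < 3" "k \<noteq> k'"
  shows "descendants h (3 * i + 1 + k) \<inter> descendants h (3 * i + 1 + k') = {}"
proof -
  have no_common: False
    if k: "k < 3" "k' < 3" "k \<noteq> k'" and l: "l \<le> l'"
      and j: "(parent ^^ l) j = 3 * i + 1 + k" "(parent ^^ l') j = 3 * i + 1 + k'" for k k' l l' j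
  proof (cases "l' - l")
    case 0
    then show False using l j k by simp
  next
    case (Suc m)
    then have "l' = Suc m + l" using l by simp
    then have "3 * i + 1 + k' = (parent ^^ Suc m) (3 * i + 1 + k)"
      using j by (simp add: funpow_add)
    also have "\<dots> = (parent ^^ m) i" using parent_child[OF k(1)] by (simp add: funpow_swap1)
    also have "\<dots> \<le> i" by (rule parent_funpow_le)
    finally show False by simp
  qed
  show ?thesis
  proof (rule equals0I)
    fix j assume "j \<in> descendants h (3 * i + 1 + k) \<inter> descendants h (3 * i + 1 + k')"
    then obtain l l' where "(parent ^^ l) j = 3 * i + 1 + k" "(parent ^^ l') j = 3 * i + 1 + k'"
      using descendants_ancestor by (metis IntD1 IntD2)
    then show False
      using no_common[OF assms(1,2,3), of l l' j] no_common[of k' k l' l j] assms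
      by (cases "l \<le> l'") auto
  qed
qed

lemma tree_model_ternary:
  assumes W: "tree_model E parent m W" and "descendants h i \<subseteq> {..<m}"
  shows "ternary E h (\<Union>j\<in>descendants h i. W j)"
  using assms(2)
proof (induction h arbitrary: i)
  case 0
  then show ?case using W by (auto simp: tree_model_def)
next
  case (Suc h)
  have WW: "W a \<inter> W b = {}" if "a < m" "b < m" "a \<noteq> b" for a b
    using W that by (simp add: tree_model_def)
  define S where "S k = (\<Union>j\<in>descendants h (3 * i + 1 + k). W j)" for k
  have sub: "descendants h (3 * i + 1 + k) \<subseteq> {..<m}" if "k < 3" for k
    using Suc.prems that by auto
  have im: "i < m" using Suc.prems by simp
  have eq: "(\<Union>j\<in>descendants (Suc h) i. W j) = W i \<union> (\<Union>k<3. S k)"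
    by (auto simp: S_def)
  have conn: "conn E (W i)" using W im by (simp add: tree_model_def)
  have tern: "ternary E h (S k)" if "k < 3" for k
    unfolding S_def using Suc.IH[OF sub[OF that]] .
  have disj: "W i \<inter> S k = {}" if "k < 3" for k
  proof -
    have "W i \<inter> W j = {}" if "j \<in> descendants h (3 * i + 1 + k)" for j
      using WW[of i j] im that sub[OF \<open>k < 3\<close>] descendants_ge[OF that] by auto
    then show ?thesis by (auto simp: S_def)
  qed
  have edge: "\<exists>a\<in>W i. \<exists>b\<in>S k. {a, b} \<in> E" if "k < 3" for k
  proof -
    have root: "3 * i + 1 + k \<in> descendants h (3 * i + 1 + k)" by (rule descendants_root)
    then have "3 * i + 1 + k < m" using sub[OF that] by auto
    then have "\<exists>a\<in>W (parent (3 * i + 1 + k)). \<exists>b\<in>W (3 * i + 1 + k). {a, b} \<in> E"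
      using W unfolding tree_model_def by auto
    then show ?thesis using root unfolding parent_child[OF that] S_def by blast
  qed
  have sib: "S k \<inter> S k' = {}" if "k < 3" "k' < 3" "k \<noteq> k'" for k k'
  proof -
    have "W a \<inter> W b = {}" if "a \<in> descendants h (3 * i + 1 + k)"
      "b \<in> descendants h (3 * i + 1 + k')" for a b
      using WW[of a b] that sub[OF \<open>k < 3\<close>] sub[OF \<open>k' < 3\<close>]
        descendants_siblings_disjoint[OF \<open>k < 3\<close> \<open>k' < 3\<close> \<open>k \<noteq> k'\<close>, of h i] by blast
    then show ?thesis unfolding S_def by blast
  qed
  show ?case unfolding eq ternary.simps
    using conn tern disj edge sib by (intro exI[of _ "W i"] exI[of _ S]) auto
qed

section \<open>Cutting off a wide piece at a small separator\<close>

text \<open>The constant \<open>2 * 3 ^ Suc t\<close> is the bound of \<open>descendants_bound\<close> at the root: so many nodes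
  contain the complete ternary tree of height \<open>t + 1\<close>.\<close>

lemma wide_sweepable_exists:
  assumes G: "simple_graph G" and wide: "\<not> narrow G (Suc t)"
  shows "\<exists>Y. sweepable (edges G) (verts G) (2 * 3 ^ Suc t) Y \<and> \<not> narrow (induced (edges G) Y) (Suc t)"
proof (cases "sweepable (edges G) (verts G) (2 * 3 ^ Suc t) (verts G)")
  case True
  have "induced (edges G) (verts G) = G"
    using G by (cases G) (auto simp: induced_def simple_graph_def)
  then show ?thesis using True wide by metis
next
  case False
  let ?E = "edges G" and ?V = "verts G" and ?w = "2 * 3 ^ Suc t :: nat"
  have finV: "finite ?V" and EV: "\<And>e. e \<in> ?E \<Longrightarrow> e \<subseteq> ?V"
    using G by (auto simp: simple_graph_def)
  then have finE: "finite ?E" using finite_subset[of ?E "Pow ?V"] by auto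
  have "parent i < i" if "0 < i" for i using that by (simp add: parent_def)
  then obtain X W where X: "frontier ?E ?V ?w ?w X" and W: "tree_model ?E parent ?w W"
    and WX: "\<And>i. i < ?w \<Longrightarrow> W i \<subseteq> X"
    using frontier_tree_model_exists[OF finE finV EV False, of parent ?w] by auto
  have swX: "sweepable ?E ?V ?w X" using X by (simp add: frontier_def)
  have sub: "descendants (Suc t) 0 \<subseteq> {..<?w}"
  proof
    fix j assume "j \<in> descendants (Suc t) 0"
    then show "j \<in> {..<?w}" using descendants_bound[of j "Suc t" 0] by (simp add: mult.commute)
  qed
  let ?T = "\<Union>j\<in>descendants (Suc t) 0. W j"
  have T: "ternary ?E (Suc t) ?T" by (rule tree_model_ternary[OF W sub])
  have TX: "?T \<subseteq> X" using WX sub by blast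
  have finX: "finite X" using finite_subset[OF sweepable_subset[OF swX] finV] .
  have "\<not> narrow (induced ?E X) (Suc t)"
  proof
    assume "narrow (induced ?E X) (Suc t)"
    then obtain Bs where Bs: "path_decomposition (induced ?E X) Bs"
      "\<And>B. B \<in> set Bs \<Longrightarrow> card B \<le> Suc t" by (auto simp: narrow_def)
    obtain i where i: "i < length Bs" "Suc (Suc t) \<le> card (Bs ! i \<inter> ?T)"
      using ternary_large_bag[OF T finite_subset[OF TX finX] TX Bs(1)] by blast
    have "Bs ! i \<subseteq> X" using path_decompositionD(3)[OF Bs(1) i(1)] by simp
    then have "card (Bs ! i \<inter> ?T) \<le> card (Bs ! i)"
      using finX by (intro card_mono) (auto intro: finite_subset)
    then show False using i Bs(2)[of "Bs ! i"] by simp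
  qed
  then show ?thesis using swX by blast
qed

text \<open>In a wide sweepable set \<open>Y\<close> of minimum size, the sweep was still narrow before the last vertex
  \<open>v\<close> was added. So deleting \<open>v\<close> makes \<open>Y\<close> narrow, and deleting the boundary
  separates what remains from the rest of the graph.\<close>

lemma wide_piece_exists:
  assumes G: "simple_graph G" and wide: "\<not> narrow G (Suc t)"
  obtains Y S where "S \<subseteq> Y" "Y \<subseteq> verts G" "card S \<le> Suc (2 * 3 ^ Suc t)"
    "boundary (edges G) Y \<subseteq> S" "\<not> narrow (induced (edges G) Y) (Suc t)"
    "narrow (induced (edges G) (Y - S)) (Suc t)"
proof -
  let ?E = "edges G" and ?V = "verts G" and ?w = "2 * 3 ^ Suc t :: nat"
  let ?P = "\<lambda>Y. sweepable ?E ?V ?w Y \<and> \<not> narrow (induced ?E Y) (Suc t)"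
  have finV: "finite ?V" using G by (simp add: simple_graph_def)
  obtain Y where Y: "?P Y" and min: "\<And>Z. ?P Z \<Longrightarrow> card Y \<le> card Z"
    using wide_sweepable_exists[OF G wide] ex_has_least_nat[of ?P _ card] by metis
  from Y have "sweepable ?E ?V ?w Y" by blast
  then show ?thesis
  proof cases
    case sweepable_empty
    have "path_decomposition (induced ?E {}) [{}]" by (auto simp: path_decomposition_iff)
    then have "narrow (induced ?E Y) (Suc t)"
      unfolding narrow_def sweepable_empty by (intro exI[of _ "[{}]"]) simp
    then show ?thesis using Y by blast
  next
    case (sweepable_insert U v)
    have finU: "finite U"
      using finite_subset[OF sweepable_subset[OF sweepable_insert(2)] finV] .
    have "card U < card Y" using sweepable_insert finU by simp
    then have U: "narrow (induced ?E U) (Suc t)"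
      using min[of U] sweepable_insert(2) by fastforce
    let ?S = "insert v (boundary ?E Y)"
    show ?thesis
    proof (rule that[of ?S Y])
      show "?S \<subseteq> Y" using boundary_subset[of ?E Y] sweepable_insert(1) by auto
      show "Y \<subseteq> ?V" using sweepable_subset Y by blast
      have "finite (boundary ?E Y)" using finite_boundary[of Y] finU sweepable_insert(1) by simp
      then show "card ?S \<le> Suc ?w"
        using sweepable_insert(1,5) card_insert_le_m1[of "Suc ?w" "boundary ?E Y" v] by simp
      show "narrow (induced ?E (Y - ?S)) (Suc t)"
        by (rule narrow_subset[OF U _ finU]) (use sweepable_insert(1) in auto)
    qed (use Y in auto)
  qed
qed

section \<open>Packing or hitting\<close>

lemma delete_verts_eq_induced:
  assumes "simple_graph G"
  shows "delete_verts G X = induced (edges G) (verts G - X)"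
  using assms by (auto simp: delete_verts_def induced_def simple_graph_def)

lemma simple_graph_induced:
  assumes "simple_graph G" "Y \<subseteq> verts G"
  shows "simple_graph (induced (edges G) Y)"
  using assms by (auto simp: simple_graph_def intro: finite_subset)

lemma packing_or_hitting_set:
  assumes "simple_graph G"
  shows "(\<exists>H :: nat \<Rightarrow> 'a ugraph. (\<forall>i<k. subgraph (H i) G \<and> \<not> narrow (H i) (Suc t)) \<and>
           (\<forall>i<k. \<forall>j<k. i \<noteq> j \<longrightarrow> verts (H i) \<inter> verts (H j) = {})) \<or>
         (\<exists>X. X \<subseteq> verts G \<and> card X \<le> Suc (2 * 3 ^ Suc t) * k \<and> narrow (delete_verts G X) (Suc t))"
  using assms
proof (induction k arbitrary: G)
  case 0
  then show ?case by simp
next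
  case (Suc k)
  let ?E = "edges G" and ?V = "verts G" and ?c = "Suc (2 * 3 ^ Suc t) :: nat"
  note G = Suc.prems
  show ?case
  proof (cases "narrow G (Suc t)")
    case True
    have "delete_verts G {} = G" by (simp add: delete_verts_def)
    then show ?thesis using True by (intro disjI2 exI[of _ "{}"]) simp
  next
    case False
    obtain Y S where Y: "S \<subseteq> Y" "Y \<subseteq> ?V" "card S \<le> ?c" "boundary ?E Y \<subseteq> S"
      "\<not> narrow (induced ?E Y) (Suc t)" "narrow (induced ?E (Y - S)) (Suc t)"
      by (rule wide_piece_exists[OF G False])
    let ?G = "delete_verts G Y"
    have G': "simple_graph ?G"
      unfolding delete_verts_eq_induced[OF G] by (rule simple_graph_induced[OF G]) auto
    consider H where "\<forall>i<k. subgraph (H i) ?G \<and> \<not> narrow (H i) (Suc t)"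
        "\<forall>i<k. \<forall>j<k. i \<noteq> j \<longrightarrow> verts (H i) \<inter> verts (H j) = {}"
      | X where "X \<subseteq> verts ?G" "card X \<le> ?c * k" "narrow (delete_verts ?G X) (Suc t)"
      using Suc.IH[OF G'] by blast
    then show ?thesis
    proof cases
      case 1
      define H' where "H' i = (case i of 0 \<Rightarrow> induced ?E Y | Suc i \<Rightarrow> H i)" for i
      have wide: "subgraph (H' i) G \<and> \<not> narrow (H' i) (Suc t)" if "i < Suc k" for i
      proof (cases i)
        case 0
        then show ?thesis using simple_graph_induced[OF G Y(2)] Y(2,5)
          by (auto simp: H'_def subgraph_def)
      next
        case (Suc i')
        then show ?thesis using 1(1) that by (auto simp: H'_def subgraph_def delete_verts_def)
      qed
      have HY: "verts (H i) \<inter> Y = {}" if "i < k" for i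
        using 1(1) that by (auto simp: subgraph_def delete_verts_def)
      have disj: "verts (H' i) \<inter> verts (H' j) = {}" if "i < Suc k" "j < Suc k" "i \<noteq> j" for i j
        using that 1(2) HY by (cases i; cases j) (auto simp: H'_def)
      show ?thesis
        by (intro disjI1 exI[of _ H'] conjI allI impI) (use wide disj in simp_all)
    next
      case 2
      let ?X = "S \<union> X"
      have "?X \<subseteq> ?V" using 2(1) Y by (auto simp: delete_verts_def)
      moreover have "card ?X \<le> ?c * Suc k"
        using card_Un_le[of S X] 2(2) Y(3) by simp
      moreover have "narrow (delete_verts G ?X) (Suc t)"
      proof -
        have "delete_verts ?G X = induced ?E (?V - (Y \<union> X))"
          unfolding delete_verts_eq_induced[OF G, symmetric] by (auto simp: delete_verts_def)
        with 2(3) have rest: "narrow (induced ?E (?V - (Y \<union> X))) (Suc t)" by simp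
        have "e \<subseteq> Y - S \<or> e \<subseteq> ?V - (Y \<union> X)"
          if e: "e \<in> ?E" "e \<subseteq> (Y - S) \<union> (?V - (Y \<union> X))" for e
        proof (rule ccontr)
          assume "\<not> ?thesis"
          then obtain a b where ab: "a \<in> e" "b \<in> e" "a \<in> Y - S" "b \<in> ?V - (Y \<union> X)"
            using e(2) by blast
          have "card e = 2" using G e(1) by (simp add: simple_graph_def)
          then have "e = {a, b}" using ab by (auto simp: card_2_iff)
          then have "a \<in> boundary ?E Y" using ab e(1) by (auto simp: boundary_def)
          then show False using Y(4) ab(3) by blast
        qed
        then have "narrow (induced ?E ((Y - S) \<union> (?V - (Y \<union> X)))) (Suc t)"
          by (intro narrow_Un Y(6) rest) auto
        moreover have "(Y - S) \<union> (?V - (Y \<union> X)) = ?V - ?X"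
          using Y(1,2) 2(1) by (auto simp: delete_verts_def)
        ultimately show ?thesis by (simp add: delete_verts_eq_induced[OF G])
      qed
      ultimately show ?thesis by (intro disjI2 exI[of _ ?X] conjI)
    qed
  qed
qed

section \<open>A computable bound\<close>

primrec recf_const :: "nat \<Rightarrow> recf" where
  "recf_const 0 = Rec_Zero"
| "recf_const (Suc n) = Rec_Comp Rec_Succ [recf_const n]"

lemma rec_eval_const: "rec_eval (recf_const n) xs n"
proof (induction n)
  case (Suc n)
  then show ?case
    by (auto intro!: rec_eval.comp[where ys = "[n]"] intro: rec_eval.intros)
qed (auto intro: rec_eval.intros)

definition recf_add :: recf where
  "recf_add = Rec_Prim (Rec_Proj 0) (Rec_Comp Rec_Succ [Rec_Proj 1])"

lemma rec_eval_proj: "i < length xs \<Longrightarrow> xs ! i = y \<Longrightarrow> rec_eval (Rec_Proj i) xs y"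
  using rec_eval.proj by blast

lemma rec_eval_add: "rec_eval recf_add [n, x] (n + x)"
  unfolding recf_add_def
proof (induction n)
  case 0
  then show ?case by (auto intro!: rec_eval.prim_0 rec_eval_proj)
next
  case (Suc n)
  have "rec_eval (Rec_Comp Rec_Succ [Rec_Proj 1]) [n, n + x, x] (Suc (n + x))"
    by (rule rec_eval.comp[where ys = "[n + x]"]) (auto intro: rec_eval_proj rec_eval.succ)
  then show ?case using rec_eval.prim_Suc[OF Suc] by simp
qed

text \<open>The exponential is obtained by primitive recursion that triples the previous value. A bound of
  this form avoids the additive constant in \<open>2 * 3 ^ (t + 1) + 1 \<le> 7 * 3 ^ t\<close>.\<close>

lemma computable_mult_power3: "computable (\<lambda>t. a * 3 ^ t)"
proof -
  let ?triple = "Rec_Comp recf_add [Rec_Proj 1, Rec_Comp recf_add [Rec_Proj 1, Rec_Proj 1]]"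
  have triple: "rec_eval ?triple [n, y] (3 * y)" for n y
  proof -
    have "rec_eval (Rec_Comp recf_add [Rec_Proj 1, Rec_Proj 1]) [n, y] (y + y)"
      by (rule rec_eval.comp[where ys = "[y, y]"]) (auto intro: rec_eval_proj rec_eval_add)
    then have "rec_eval ?triple [n, y] (y + (y + y))"
      by (intro rec_eval.comp[where ys = "[y, y + y]"]) (auto intro: rec_eval_proj rec_eval_add)
    then show ?thesis by (simp add: numeral_3_eq_3)
  qed
  have "rec_eval (Rec_Prim (recf_const a) ?triple) [t] (a * 3 ^ t)" for t
  proof (induction t)
    case 0
    then show ?case by (simp add: rec_eval.prim_0 rec_eval_const)
  next
    case (Suc t)
    have "rec_eval (Rec_Prim (recf_const a) ?triple) [Suc t] (3 * (a * 3 ^ t))"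
      by (rule rec_eval.prim_Suc[OF Suc triple])
    then show ?case by (simp add: ac_simps)
  qed
  then show ?thesis unfolding computable_def by blast
qed

theorem corollary1p2:
  "\<exists>c :: nat \<Rightarrow> nat. computable c \<and>
     (\<forall>(t :: nat) (G :: 'a ugraph) (k :: nat). simple_graph G \<longrightarrow>
        (\<exists>H :: nat \<Rightarrow> 'a ugraph.
           (\<forall>i<k. subgraph (H i) G \<and> pathwidth (H i) \<ge> int t + 1) \<and>
           (\<forall>i<k. \<forall>j<k. i \<noteq> j \<longrightarrow> verts (H i) \<inter> verts (H j) = {})) \<or>
        (\<exists>X. X \<subseteq> verts G \<and> card X \<le> c t * k \<and> pathwidth (delete_verts G X) \<le> int t))"
proof (intro exI[of _ "\<lambda>t. 7 * 3 ^ t"] conjI allI impI)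
  show "computable (\<lambda>t. 7 * 3 ^ t)" by (rule computable_mult_power3)
  fix t k :: nat and G :: "'a ugraph"
  assume G: "simple_graph G"
  have wide: "pathwidth H \<ge> int t + 1" if "subgraph H G" "\<not> narrow H (Suc t)" for H
    using that pathwidth_le_iff_narrow[of H t] by (simp add: subgraph_def)
  have thin: "pathwidth (delete_verts G X) \<le> int t" if "narrow (delete_verts G X) (Suc t)" for X
    using that pathwidth_le_iff_narrow[OF simple_graph_induced[OF G], of "verts G - X" t]
    by (simp add: delete_verts_eq_induced[OF G])
  have "Suc (2 * 3 ^ Suc t) * k \<le> (7 * 3 ^ t) * k" by (intro mult_le_mono1) simp
  then show "(\<exists>H :: nat \<Rightarrow> 'a ugraph.
           (\<forall>i<k. subgraph (H i) G \<and> pathwidth (H i) \<ge> int t + 1) \<and>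
           (\<forall>i<k. \<forall>j<k. i \<noteq> j \<longrightarrow> verts (H i) \<inter> verts (H j) = {})) \<or>
        (\<exists>X. X \<subseteq> verts G \<and> card X \<le> 7 * 3 ^ t * k \<and> pathwidth (delete_verts G X) \<le> int t)"
    using packing_or_hitting_set[OF G, of k t] wide thin by (meson order_trans)
qed

end
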